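(* Let $k\geq1$ and let $\mathcal{M}$ be a countable homogeneous structure in a finite relational language in which every relation symbol has arity $k+1$, such that $\mathrm{Aut}(M)$ acts transitively on $k$-tuples of distinct elements and $\mathrm{Age}(M)$ is $k$-overlap closed. Then every $\mathrm{Aut}(M)$-invariant Keisler measure on $M$ in a single variable $x$ is exchangeable.
   Context: Relations never hold on tuples with repeated entries. Homogeneous: every isomorphism between finite substructures of $M$ extends to an automorphism. $\mathrm{Age}(M)$: the class of finite structures (with domains finite subsets of $\mathbb{N}$) embeddable in $M$; $\mathcal{C}[r]$ denotes members with domain $[r]$. $k$-overlap closed: all arities exceed $k$ and for every $r>k$ there are constants $C(r),\alpha(r)>0$ such that for arbitrarily large $n$ there is an $r$-uniform hypergraph $\mathbb{K}$ on $n$ vertices with at least $C(r)n^{k+\alpha(r)}$ hyperedges, no two hyperedges meeting in more than $k$ vertices, and such that for all $H_1,H_2\in\mathcal{C}[r]$ and every structure $G_0$ on the vertices of $\mathbb{K}$ whose induced substructure on each hyperedge is isomorphic to $H_1$ or $H_2$, there is an injective homomorphism of $G_0$ into a member of $\mathcal{C}$ with $n$ elements restricting to an embedding on each hyperedge. A Keisler measure on $M$ in $x$ is a regular Borel probability measure on $S_x(M)$; invariant means $\mathrm{Aut}(M)$-invariant; $\mu(\phi(x,\bar a))$ is the measure of the set of types containing $\phi(x,\bar a)$. $\mu$ is exchangeable if for every $n$, all $n$-tuples $\bar a,\bar b$ of pairwise distinct elements of $M$, and every Boolean combination $\phi(x,y_1,\dots,y_n)$ of atomic formulas each mentioning $x$,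 $\mu(\phi(x,\bar a))=\mu(\phi(x,\bar b))$ (equivalently, the induced random expansion of $M$ recording the atomic relations between $x$ and tuples from $M$ is invariant under all permutations of $M$). *)

theory Defs
  imports "HOL-Probability.Probability"
begin

section \<open>Relational structures\<close>

record 'r language =
  symbols :: "'r set"
  arity :: "'r \<Rightarrow> nat"

record ('a, 'r) struct =
  univ :: "'a set"
  interp :: "'r \<Rightarrow> 'a list set"

text \<open>Relations never hold on tuples with repeated entries. The interpretation of symbols outside
  the language is left unspecified, and no notion below looks at it.\<close>

definition is_structure :: "'r language \<Rightarrow> ('a, 'r) struct \<Rightarrow> bool" where
  "is_structure L A \<longleftrightarrow>
     (\<forall>R \<in> symbols L. interp A R \<subseteq> {xs. set xs \<subseteq> univ A \<and> length xs = arity L R \<and> distinct xs})"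

definition substructure :: "('a, 'r) struct \<Rightarrow> 'a set \<Rightarrow> ('a, 'r) struct" where
  "substructure A X = \<lparr> univ = X, interp = (\<lambda>R. interp A R \<inter> lists X) \<rparr>"

definition is_hom :: "'r language \<Rightarrow> ('a \<Rightarrow> 'b) \<Rightarrow> ('a, 'r) struct \<Rightarrow> ('b, 'r) struct \<Rightarrow> bool" where
  "is_hom L f A B \<longleftrightarrow> f ` univ A \<subseteq> univ B \<and>
     (\<forall>R \<in> symbols L. \<forall>xs \<in> lists (univ A). xs \<in> interp A R \<longrightarrow> map f xs \<in> interp B R)"

definition is_embedding :: "'r language \<Rightarrow> ('a \<Rightarrow> 'b) \<Rightarrow> ('a, 'r) struct \<Rightarrow> ('b, 'r) struct \<Rightarrow> bool" where
  "is_embedding L f A B \<longleftrightarrow> f ` univ A \<subseteq> univ B \<and> inj_on f (univ A) \<and>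
     (\<forall>R \<in> symbols L. \<forall>xs \<in> lists (univ A). xs \<in> interp A R \<longleftrightarrow> map f xs \<in> interp B R)"

definition is_iso :: "'r language \<Rightarrow> ('a \<Rightarrow> 'b) \<Rightarrow> ('a, 'r) struct \<Rightarrow> ('b, 'r) struct \<Rightarrow> bool" where
  "is_iso L f A B \<longleftrightarrow> is_embedding L f A B \<and> f ` univ A = univ B"

definition isomorphic :: "'r language \<Rightarrow> ('a, 'r) struct \<Rightarrow> ('b, 'r) struct \<Rightarrow> bool" where
  "isomorphic L A B \<longleftrightarrow> (\<exists>f. is_iso L f A B)"

definition Aut :: "'r language \<Rightarrow> ('a, 'r) struct \<Rightarrow> ('a \<Rightarrow> 'a) set" where
  "Aut L A = {f. is_iso L f A A}"

definition homogeneous :: "'r language \<Rightarrow> ('a, 'r) struct \<Rightarrow> bool" where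
  "homogeneous L M \<longleftrightarrow>
     (\<forall>X Y f. finite X \<and> X \<subseteq> univ M \<and> finite Y \<and> Y \<subseteq> univ M \<and>
        is_iso L f (substructure M X) (substructure M Y) \<longrightarrow>
        (\<exists>g \<in> Aut L M. \<forall>x \<in> X. g x = f x))"

definition distinct_tuples :: "nat \<Rightarrow> 'a set \<Rightarrow> 'a list set" where
  "distinct_tuples n X = {xs. length xs = n \<and> set xs \<subseteq> X \<and> distinct xs}"

definition transitive_on_tuples :: "'r language \<Rightarrow> nat \<Rightarrow> ('a, 'r) struct \<Rightarrow> bool" where
  "transitive_on_tuples L k M \<longleftrightarrow>
     (\<forall>as \<in> distinct_tuples k (univ M). \<forall>bs \<in> distinct_tuples k (univ M).
        \<exists>g \<in> Aut L M. map g as = bs)"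

definition Age :: "'r language \<Rightarrow> ('a, 'r) struct \<Rightarrow> (nat, 'r) struct set" where
  "Age L M = {A. is_structure L A \<and> finite (univ A) \<and> (\<exists>f. is_embedding L f A M)}"

definition members_on :: "(nat, 'r) struct set \<Rightarrow> nat \<Rightarrow> (nat, 'r) struct set" where
  "members_on \<C> r = {A \<in> \<C>. univ A = {1..r}}"


section \<open>Overlap closed classes\<close>

definition uniform_hypergraph :: "nat \<Rightarrow> nat set \<Rightarrow> nat set set \<Rightarrow> bool" where
  "uniform_hypergraph r V E \<longleftrightarrow> finite V \<and> (\<forall>e \<in> E. e \<subseteq> V \<and> card e = r)"

text \<open>The structure \<open>G0\<close> is constrained only inside the hyperedges: it may also have tuples that are
  not contained in any hyperedge.\<close>

definition overlap_closed :: "'r language \<Rightarrow> nat \<Rightarrow> (nat, 'r) struct set \<Rightarrow> bool" where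
  "overlap_closed L k \<C> \<longleftrightarrow>
     (\<forall>R \<in> symbols L. arity L R > k) \<and>
     (\<forall>r > k. \<exists>(c::real) > 0. \<exists>(\<alpha>::real) > 0. \<forall>N. \<exists>n \<ge> N. \<exists>V E.
        uniform_hypergraph r V E \<and> card V = n \<and>
        real (card E) \<ge> c * real n powr (real k + \<alpha>) \<and>
        (\<forall>e \<in> E. \<forall>e' \<in> E. e \<noteq> e' \<longrightarrow> card (e \<inter> e') \<le> k) \<and>
        (\<forall>H1 \<in> members_on \<C> r. \<forall>H2 \<in> members_on \<C> r. \<forall>G0 :: (nat, 'r) struct.
           is_structure L G0 \<and> univ G0 = V \<and>
           (\<forall>e \<in> E. isomorphic L (substructure G0 e) H1 \<or> isomorphic L (substructure G0 e) H2) \<longrightarrow>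
           (\<exists>G \<in> \<C>. card (univ G) = n \<and>
              (\<exists>f. is_hom L f G0 G \<and> inj_on f (univ G0) \<and>
                   (\<forall>e \<in> E. is_embedding L f (substructure G0 e) G)))))"


section \<open>First-order formulas with parameters\<close>

datatype 'a trm = Var nat | Par 'a

datatype (rels: 'r, pars: 'a) fm =
    Rel 'r "'a trm list"
  | Eq "'a trm" "'a trm"
  | Neg "('r, 'a) fm"
  | Conj "('r, 'a) fm" "('r, 'a) fm"
  | Ex nat "('r, 'a) fm"

primrec eval_trm :: "(nat \<Rightarrow> 'a) \<Rightarrow> 'a trm \<Rightarrow> 'a" where
  "eval_trm e (Var v) = e v"
| "eval_trm e (Par a) = a"

primrec sat :: "('a, 'r) struct \<Rightarrow> (nat \<Rightarrow> 'a) \<Rightarrow> ('r, 'a) fm \<Rightarrow> bool" where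
  "sat M e (Rel R ts) \<longleftrightarrow> map (eval_trm e) ts \<in> interp M R"
| "sat M e (Eq s t) \<longleftrightarrow> eval_trm e s = eval_trm e t"
| "sat M e (Neg \<phi>) \<longleftrightarrow> \<not> sat M e \<phi>"
| "sat M e (Conj \<phi> \<psi>) \<longleftrightarrow> sat M e \<phi> \<and> sat M e \<psi>"
| "sat M e (Ex v \<phi>) \<longleftrightarrow> (\<exists>a \<in> univ M. sat M (e(v := a)) \<phi>)"

primrec wf_fm :: "'r language \<Rightarrow> ('r, 'a) fm \<Rightarrow> bool" where
  "wf_fm L (Rel R ts) \<longleftrightarrow> R \<in> symbols L \<and> length ts = arity L R"
| "wf_fm L (Eq s t) \<longleftrightarrow> True"
| "wf_fm L (Neg \<phi>) \<longleftrightarrow> wf_fm L \<phi>"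
| "wf_fm L (Conj \<phi> \<psi>) \<longleftrightarrow> wf_fm L \<phi> \<and> wf_fm L \<psi>"
| "wf_fm L (Ex v \<phi>) \<longleftrightarrow> wf_fm L \<phi>"

primrec free_vars :: "('r, 'a) fm \<Rightarrow> nat set" where
  "free_vars (Rel R ts) = {v. Var v \<in> set ts}"
| "free_vars (Eq s t) = {v. Var v \<in> {s, t}}"
| "free_vars (Neg \<phi>) = free_vars \<phi>"
| "free_vars (Conj \<phi> \<psi>) = free_vars \<phi> \<union> free_vars \<psi>"
| "free_vars (Ex v \<phi>) = free_vars \<phi> - {v}"

text \<open>The variable \<open>x\<close> is \<open>Var 0\<close>; the variables \<open>y\<^sub>1, \<dots>, y\<^sub>n\<close> are \<open>Var 1, \<dots>, Var n\<close>.\<close>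

definition formulas_x :: "'r language \<Rightarrow> ('a, 'r) struct \<Rightarrow> ('r, 'a) fm set" where
  "formulas_x L M = {\<phi>. wf_fm L \<phi> \<and> pars \<phi> \<subseteq> univ M \<and> free_vars \<phi> \<subseteq> {0}}"

primrec inst_trm :: "(nat \<Rightarrow> 'a option) \<Rightarrow> 'a trm \<Rightarrow> 'a trm" where
  "inst_trm s (Var v) = (case s v of None \<Rightarrow> Var v | Some a \<Rightarrow> Par a)"
| "inst_trm s (Par a) = Par a"

primrec inst :: "(nat \<Rightarrow> 'a option) \<Rightarrow> ('r, 'a) fm \<Rightarrow> ('r, 'a) fm" where
  "inst s (Rel R ts) = Rel R (map (inst_trm s) ts)"
| "inst s (Eq t u) = Eq (inst_trm s t) (inst_trm s u)"
| "inst s (Neg \<phi>) = Neg (inst s \<phi>)"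
| "inst s (Conj \<phi> \<psi>) = Conj (inst s \<phi>) (inst s \<psi>)"
| "inst s (Ex v \<phi>) = Ex v (inst (s(v := None)) \<phi>)"

text \<open>\<open>inst_y \<phi> as\<close> is \<open>\<phi>(x, as)\<close>.\<close>

definition inst_y :: "('r, 'a) fm \<Rightarrow> 'a list \<Rightarrow> ('r, 'a) fm" where
  "inst_y \<phi> as = inst (\<lambda>v. if 1 \<le> v \<and> v \<le> length as then Some (as ! (v - 1)) else None) \<phi>"

text \<open>Boolean combinations of parameter-free atomic formulas in \<open>x, y\<^sub>1, \<dots>, y\<^sub>n\<close>, each of which
  mentions \<open>x\<close>.\<close>

inductive bool_comb_x :: "'r language \<Rightarrow> nat \<Rightarrow> ('r, 'a) fm \<Rightarrow> bool" for L n where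
  "R \<in> symbols L \<Longrightarrow> length ts = arity L R \<Longrightarrow> set ts \<subseteq> Var ` {0..n} \<Longrightarrow> Var 0 \<in> set ts \<Longrightarrow>
     bool_comb_x L n (Rel R ts)"
| "{s, t} \<subseteq> Var ` {0..n} \<Longrightarrow> Var 0 \<in> {s, t} \<Longrightarrow> bool_comb_x L n (Eq s t)"
| "bool_comb_x L n \<phi> \<Longrightarrow> bool_comb_x L n (Neg \<phi>)"
| "bool_comb_x L n \<phi> \<Longrightarrow> bool_comb_x L n \<psi> \<Longrightarrow> bool_comb_x L n (Conj \<phi> \<psi>)"


section \<open>Types and Keisler measures\<close>

text \<open>The set \<open>S\<^sub>x(M)\<close> of complete types over \<open>M\<close>: maximal sets of formulas in \<open>x\<close> with parameters in
  \<open>M\<close> that are finitely satisfiable in \<open>M\<close>.\<close>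

definition types_x :: "'r language \<Rightarrow> ('a, 'r) struct \<Rightarrow> ('r, 'a) fm set set" where
  "types_x L M = {p. p \<subseteq> formulas_x L M \<and>
     (\<forall>F. finite F \<and> F \<subseteq> p \<longrightarrow> (\<exists>a \<in> univ M. \<forall>\<phi> \<in> F. sat M (\<lambda>_. a) \<phi>)) \<and>
     (\<forall>\<phi> \<in> formulas_x L M. \<phi> \<in> p \<or> Neg \<phi> \<in> p)}"

definition types_containing ::
    "'r language \<Rightarrow> ('a, 'r) struct \<Rightarrow> ('r, 'a) fm \<Rightarrow> ('r, 'a) fm set set" where
  "types_containing L M \<phi> = {p \<in> types_x L M. \<phi> \<in> p}"

definition stone_topology :: "'r language \<Rightarrow> ('a, 'r) struct \<Rightarrow> ('r, 'a) fm set topology" where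
  "stone_topology L M = topology_generated_by (types_containing L M ` formulas_x L M)"

definition regular_borel_measure :: "'b topology \<Rightarrow> 'b measure \<Rightarrow> bool" where
  "regular_borel_measure T \<mu> \<longleftrightarrow>
     space \<mu> = topspace T \<and> sets \<mu> = sigma_sets (topspace T) {U. openin T U} \<and>
     (\<forall>B \<in> sets \<mu>.
        emeasure \<mu> B = (INF U \<in> {U. openin T U \<and> B \<subseteq> U}. emeasure \<mu> U) \<and>
        emeasure \<mu> B = (SUP K \<in> {K. compactin T K \<and> K \<subseteq> B}. emeasure \<mu> K))"

definition keisler_measure :: "'r language \<Rightarrow> ('a, 'r) struct \<Rightarrow> ('r, 'a) fm set measure \<Rightarrow> bool" where
  "keisler_measure L M \<mu> \<longleftrightarrow> prob_space \<mu> \<and> regular_borel_measure (stone_topology L M) \<mu>"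

text \<open>An automorphism acts on types by moving the parameters of formulas.\<close>

definition act_type :: "('a \<Rightarrow> 'a) \<Rightarrow> ('r, 'a) fm set \<Rightarrow> ('r, 'a) fm set" where
  "act_type g p = map_fm (\<lambda>R. R) g ` p"

definition invariant_measure :: "'r language \<Rightarrow> ('a, 'r) struct \<Rightarrow> ('r, 'a) fm set measure \<Rightarrow> bool" where
  "invariant_measure L M \<mu> \<longleftrightarrow>
     (\<forall>g \<in> Aut L M. \<forall>B \<in> sets \<mu>. emeasure \<mu> (act_type g ` B) = emeasure \<mu> B)"

definition exchangeable :: "'r language \<Rightarrow> ('a, 'r) struct \<Rightarrow> ('r, 'a) fm set measure \<Rightarrow> bool" where
  "exchangeable L M \<mu> \<longleftrightarrow>
     (\<forall>n. \<forall>as \<in> distinct_tuples n (univ M). \<forall>bs \<in> distinct_tuples n (univ M).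
        \<forall>\<phi>. bool_comb_x L n \<phi> \<longrightarrow>
          emeasure \<mu> (types_containing L M (inst_y \<phi> as)) =
          emeasure \<mu> (types_containing L M (inst_y \<phi> bs)))"

end

theory Submission imports Defs begin

text \<open>Suppose that \<open>\<mu>(\<phi>(x, a))\<close> and \<open>\<mu>(\<phi>(x, b))\<close> differ for two \<open>r\<close>-tuples with \<open>r > k\<close>, and let
  \<open>H\<^sub>1\<close>, \<open>H\<^sub>2\<close> be the structures that they induce. On the hyperedges of a hypergraph on \<open>n\<close> vertices
  from the definition of overlap closedness, put copies of \<open>H\<^sub>1\<close> or \<open>H\<^sub>2\<close> at random and map the
  result to \<open>M\<close>. A type over the image determines only \<open>O(n\<^sup>k)\<close> bits, namely its atomic formulas, so
  the set of hyperedges on which it satisfies \<open>\<phi>\<close> is one of \<open>2\<close> to the \<open>O(n\<^sup>k)\<close> sets \<open>T\<close>, which do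
  not depend on the random choice. By an exponential moment bound and the union bound (there are at
  least \<open>c\<close> times \<open>n\<close> to the power \<open>k + \<alpha>\<close> hyperedges), for some choice each \<open>T\<close> contains almost as
  many hyperedges of the first kind as of the second. Integrating over \<open>\<mu>\<close>, which by homogeneity and
  invariance assigns every copy of \<open>H\<^sub>i\<close> the same value, gives a contradiction. For \<open>r \<le> k\<close> no
  relation holds on an \<open>r\<close>-set, and homogeneity alone suffices.\<close>

section \<open>Balanced subsets\<close>

text \<open>The exponential moment of a fair sign is \<open>cosh l\<close>.
  \<open>Hoeffdings_lemma_aux\<close>, for an interval of length \<open>2 * l\<close> and weight
  1/2, is the logarithmic form of this bound.\<close>

lemma cosh_le_exp_half_square:
  fixes l :: real
  assumes "l \<ge> 0"
  shows "cosh l \<le> exp (l\<^sup>2 / 2)"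
proof -
  have "- l + ln (1 + 1 / 2 * (exp (2 * l) - 1)) \<le> l\<^sup>2 / 2"
    using Hoeffdings_lemma_aux[of "2 * l" "1 / 2"] assms by (simp add: power2_eq_square)
  moreover have "1 + 1 / 2 * (exp (2 * l) - 1) = exp l * cosh l"
    by (simp add: cosh_field_def exp_minus field_simps power2_eq_square flip: exp_double exp_add)
  ultimately have "ln (cosh l) \<le> l\<^sup>2 / 2"
    by (simp add: ln_mult)
  then show ?thesis
    by (metis cosh_real_pos exp_le_cancel_iff exp_ln)
qed

text \<open>For finite \<open>T\<close> this is the sum over \<open>T\<close> of the signs that are
  1 on \<open>S\<close> and -1 off \<open>S\<close>. For uniformly random \<open>S\<close> the signs
  are independent and fair.\<close>

definition imbalance :: "'e set \<Rightarrow> 'e set \<Rightarrow> real" where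
  "imbalance S T = real (card (T \<inter> S)) - real (card (T - S))"

text \<open>Up to the factor \<open>2 ^ card E\<close>, the left side is an exponential moment for
  uniformly random \<open>S\<close>. By independence it factors over the points of \<open>E\<close>.
  A point outside \<open>T\<close> contributes the factor 2, which obeys the same bound as the
  others.\<close>

lemma sum_exp_imbalance:
  assumes "finite E" "T \<subseteq> E"
  shows "(\<Sum>S\<in>Pow E. exp (l * imbalance S T)) \<le> 2 ^ card E * exp (real (card E) * (l\<^sup>2 / 2))"
proof -
  define f where "f s e = (if e \<in> T then exp (s * l) else 1)" for s :: real and e
  have prod_f: "prod (f s) A = exp (s * l * card (A \<inter> T))" if "A \<subseteq> E" for s A
  proof -
    have "finite A" using that assms finite_subset by blast
    then have "prod (f s) A = (\<Prod>e\<in>A \<inter> T. exp (s * l))"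
      unfolding f_def by (rule prod.inter_restrict[symmetric])
    then show ?thesis by (simp add: exp_of_nat_mult flip: mult.commute[of "real (card (A \<inter> T))"])
  qed
  have "exp (l * imbalance S T) = prod (f 1) S * prod (f (-1)) (E - S)" if "S \<in> Pow E" for S
  proof -
    have "(E - S) \<inter> T = T - S" using assms by auto
    then show ?thesis
      using that by (simp add: prod_f imbalance_def algebra_simps Int_commute flip: exp_add)
  qed
  \<comment> \<open>Multiplying out the product of these binomials gives one summand for each subset
    \<open>S\<close> of \<open>E\<close>.\<close>
  then have "(\<Sum>S\<in>Pow E. exp (l * imbalance S T)) = (\<Prod>e\<in>E. f 1 e + f (-1) e)"
    using assms by (simp add: prod_add)
  also have "\<dots> \<le> (\<Prod>e\<in>E. 2 * exp (l\<^sup>2 / 2))"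
  proof (intro prod_mono conjI)
    fix e
    have "exp l + exp (- l) = 2 * cosh \<bar>l\<bar>" by (simp add: cosh_field_def abs_if)
    also have "\<dots> \<le> 2 * exp (l\<^sup>2 / 2)" using cosh_le_exp_half_square[of "\<bar>l\<bar>"] by simp
    finally show "f 1 e + f (-1) e \<le> 2 * exp (l\<^sup>2 / 2)"
      by (auto simp: f_def)
  qed (auto simp: f_def add_nonneg_nonneg)
  also have "\<dots> = 2 ^ card E * exp (real (card E) * (l\<^sup>2 / 2))"
    by (simp add: power_mult_distrib flip: exp_of_nat_mult)
  finally show ?thesis .
qed

text \<open>Chernoff bound and union bound. If every \<open>S\<close> had a bad \<open>T\<close>,
  the weights \<open>w S T\<close> summed over \<open>T\<close> would be at least
  \<open>exp (\<epsilon>\<^sup>2 * card E)\<close> for each \<open>S\<close>, whereas by the moment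
  bound their average over \<open>S\<close> is at most
  \<open>2 * card \<F> * exp (\<epsilon>\<^sup>2 / 2 * card E)\<close>.\<close>

lemma exists_balanced_subset:
  fixes \<epsilon> :: real and E :: "'e set"
  assumes "finite E" "finite \<F>" "\<F> \<subseteq> Pow E" "\<epsilon> > 0"
    and few: "2 * real (card \<F>) < exp (\<epsilon>\<^sup>2 / 2 * card E)"
  obtains S where "S \<subseteq> E" "\<And>T. T \<in> \<F> \<Longrightarrow> \<bar>imbalance S T\<bar> \<le> \<epsilon> * card E"
proof (rule ccontr)
  note hyp = that
  assume "\<not> thesis"
  then have bad: "\<exists>T\<in>\<F>. \<bar>imbalance S T\<bar> > \<epsilon> * card E" if "S \<subseteq> E" for S
    using \<open>S \<subseteq> E\<close> \<open>\<not> thesis\<close> hyp by (meson not_le)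
  \<comment> \<open>The two terms control both signs of the imbalance. The factor \<epsilon> in the
    exponent is the value of \<open>l\<close> that minimises
    \<open>l\<^sup>2 / 2 - l * \<epsilon>\<close>.\<close>
  define w where "w S T = exp (\<epsilon> * imbalance S T) + exp (- \<epsilon> * imbalance S T)" for S T :: "'e set"
  have "exp (\<epsilon>\<^sup>2 * card E) \<le> (\<Sum>T\<in>\<F>. w S T)" if S: "S \<in> Pow E" for S
  proof -
    obtain T where T: "T \<in> \<F>" "\<bar>imbalance S T\<bar> > \<epsilon> * card E" using bad S by auto
    have "\<epsilon>\<^sup>2 * card E \<le> \<epsilon> * \<bar>imbalance S T\<bar>"
      using T(2) assms(4) by (simp add: power2_eq_square mult.assoc)
    then have "exp (\<epsilon>\<^sup>2 * card E) \<le> exp (\<epsilon> * \<bar>imbalance S T\<bar>)" by simp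
    also have "\<dots> \<le> w S T" by (simp add: w_def abs_if)
    also have "\<dots> \<le> (\<Sum>T\<in>\<F>. w S T)"
      by (rule member_le_sum) (use T(1) assms(2) in \<open>auto simp: w_def add_nonneg_nonneg\<close>)
    finally show ?thesis .
  qed
  then have "(\<Sum>S\<in>Pow E. exp (\<epsilon>\<^sup>2 * card E)) \<le> (\<Sum>S\<in>Pow E. \<Sum>T\<in>\<F>. w S T)"
    by (rule sum_mono)
  also have "\<dots> = (\<Sum>T\<in>\<F>. \<Sum>S\<in>Pow E. w S T)"
    by (rule sum.swap)
  also have "\<dots> \<le> (\<Sum>T\<in>\<F>. 2 * (2 ^ card E * exp (real (card E) * (\<epsilon>\<^sup>2 / 2))))"
  proof (rule sum_mono)
    fix T assume "T \<in> \<F>"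
    then have "T \<subseteq> E" using assms(3) by auto
    from sum_exp_imbalance[OF assms(1) this, of \<epsilon>] sum_exp_imbalance[OF assms(1) this, of "- \<epsilon>"]
    show "(\<Sum>S\<in>Pow E. w S T) \<le> 2 * (2 ^ card E * exp (real (card E) * (\<epsilon>\<^sup>2 / 2)))"
      by (simp add: w_def sum.distrib)
  qed
  finally have "2 ^ card E * exp (\<epsilon>\<^sup>2 * card E)
      \<le> 2 ^ card E * (2 * card \<F> * exp (\<epsilon>\<^sup>2 / 2 * card E))"
    using assms(1) by (simp add: card_Pow mult_ac)
  then have "exp (\<epsilon>\<^sup>2 * card E) \<le> 2 * card \<F> * exp (\<epsilon>\<^sup>2 / 2 * card E)"
    by simp
  also have "exp (\<epsilon>\<^sup>2 * card E) = exp (\<epsilon>\<^sup>2 / 2 * card E) * exp (\<epsilon>\<^sup>2 / 2 * card E)"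
    by (simp flip: exp_add)
  finally show False using few by simp
qed

text \<open>The exponent on the left has order \<open>n ^ k\<close>, which \<open>m\<close> outgrows
  because \<alpha> is positive. In the application \<open>d * (n + 1) ^ k\<close> bounds the number
  of atomic formulas, and the added 1 accounts for one further set in the family.\<close>

lemma eventually_few_patterns:
  fixes c \<alpha> \<delta> :: real and k d :: nat
  assumes "c > 0" "\<alpha> > 0" "\<delta> > 0"
  obtains N where "N \<ge> 1"
    "\<And>n m. n \<ge> N \<Longrightarrow> m \<ge> c * real n powr (real k + \<alpha>) \<Longrightarrow>
        2 * (2 ^ (d * (n + 1) ^ k) + 1) < exp (\<delta> * m)"
proof -
  \<comment> \<open>The summand 2 pays for the outer factor 2 and the added 1, since
    \<open>2 * (a + 1) \<le> 4 * a \<le> exp 2 * a\<close> for \<open>a \<ge> 1\<close>. The power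
    of 2 comes from \<open>n + 1 \<le> 2 * n\<close>.\<close>
  define K where "K = (2 + d * 2 ^ k) / (\<delta> * c)"
  have "filterlim (\<lambda>n. real n powr \<alpha>) at_top sequentially"
    using assms(2) by real_asymp
  then have "eventually (\<lambda>n. real n powr \<alpha> > K) sequentially"
    by (simp add: filterlim_at_top_dense)
  then obtain N where N: "\<And>n. n \<ge> N \<Longrightarrow> real n powr \<alpha> > K"
    by (auto simp: eventually_sequentially)
  show thesis
  proof (rule that[of "max 1 N"])
    fix n and m :: real assume n: "n \<ge> max 1 N" and m: "m \<ge> c * real n powr (real k + \<alpha>)"
    have n1: "real n \<ge> 1" using n by simp
    have nk: "real n ^ k \<ge> 1" using n1 by simp
    have "real ((n + 1) ^ k) \<le> (2 * real n) ^ k"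
      unfolding of_nat_power using n1 by (intro power_mono) auto
    then have "d * real ((n + 1) ^ k) \<le> d * 2 ^ k * real n ^ k"
      by (simp add: power_mult_distrib mult_left_mono mult.assoc)
    then have "2 + real (d * (n + 1) ^ k) \<le> (2 + d * 2 ^ k) * real n ^ k"
      using nk by (simp add: algebra_simps)
    also have "\<dots> = \<delta> * c * (real n ^ k * K)"
      using assms by (simp add: K_def)
    also have "\<dots> < \<delta> * c * (real n ^ k * real n powr \<alpha>)"
      using assms nk N[of n] n by (intro mult_strict_left_mono) auto
    also have "\<dots> = \<delta> * (c * real n powr (real k + \<alpha>))"
      using n1 by (simp add: powr_add powr_realpow)
    also have "\<dots> \<le> \<delta> * m"
      using m assms by simp
    finally have lt: "exp (2 + real (d * (n + 1) ^ k)) < exp (\<delta> * m)" by simp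
    have e2: "exp 1 \<ge> (2::real)" using exp_ge_add_one_self[of 1] by simp
    have "(2::real) ^ (d * (n + 1) ^ k) \<le> exp 1 ^ (d * (n + 1) ^ k)"
      using e2 by (intro power_mono) auto
    moreover have "(4::real) \<le> exp 2"
      using mult_mono[OF e2 e2] by (simp flip: exp_add)
    ultimately have "4 * 2 ^ (d * (n + 1) ^ k) \<le> exp 2 * exp (1::real) ^ (d * (n + 1) ^ k)"
      by (intro mult_mono) auto
    moreover have "(1::real) \<le> 2 ^ (d * (n + 1) ^ k)" by simp
    moreover have "2 * (a + 1) \<le> b" if "4 * a \<le> b" "1 \<le> a" for a b :: real
      using that by simp
    ultimately have "2 * (2 ^ (d * (n + 1) ^ k) + 1) \<le> exp 2 * exp (1::real) ^ (d * (n + 1) ^ k)"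
      by blast
    also have "\<dots> = exp (2 + real (d * (n + 1) ^ k))"
      by (simp add: exp_add flip: exp_of_nat_mult)
    finally show "2 * (2 ^ (d * (n + 1) ^ k) + 1) < exp (\<delta> * m)" using lt by linarith
  qed simp
qed

text \<open>With \<open>a = card S\<close> and \<open>b = card (E - S)\<close>, the expected
  imbalance of the set of occurring events is \<open>a * p\<^sub>1 - b * p\<^sub>2\<close>, so this
  number is at most \<open>d\<close> in absolute value. Balance of \<open>E\<close> itself bounds
  \<open>a - b\<close> by \<open>d\<close>, and the identity \<open>(a + b) * (p\<^sub>1 -
  p\<^sub>2) = 2 * (a * p\<^sub>1 - b * p\<^sub>2) - (a - b) * (p\<^sub>1 + p\<^sub>2)\<close>
  combines the two bounds.\<close>

lemma (in prob_space) prob_difference_le_imbalance: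
  fixes p\<^sub>1 p\<^sub>2 d :: real
  assumes E: "finite E" "S \<subseteq> E"
    and A: "\<And>e. e \<in> E \<Longrightarrow> A e \<in> events" "\<And>e. e \<in> E \<Longrightarrow> prob (A e) = (if e \<in> S then p\<^sub>1 else p\<^sub>2)"
    and pat: "\<And>x. x \<in> space M \<Longrightarrow> \<bar>imbalance S {e \<in> E. x \<in> A e}\<bar> \<le> d"
    and bal: "\<bar>imbalance S E\<bar> \<le> d"
    and p: "p\<^sub>1 \<in> {0..1}" "p\<^sub>2 \<in> {0..1}"
  shows "card E * \<bar>p\<^sub>1 - p\<^sub>2\<bar> \<le> 4 * d"
proof -
  define a b where "a = real (card S)" and "b = real (card (E - S))"
  have fin: "finite S" "finite (E - S)" using E finite_subset by auto
  define X where "X x = (\<Sum>e\<in>S. indicator (A e) x) - (\<Sum>e\<in>E - S. indicator (A e) x :: real)" for x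
  have int: "integrable M (indicator (A e) :: _ \<Rightarrow> real)" if "e \<in> E" for e
    using A(1) that by (simp add: emeasure_eq_measure)
  have "X x = imbalance S {e \<in> E. x \<in> A e}" for x
  proof -
    have "(\<Sum>e\<in>B. indicator (A e) x :: real) = card {e \<in> B. x \<in> A e}" if "finite B" for B
      using that by (simp add: indicator_def sum.If_cases Int_def)
    moreover have "{e \<in> S. x \<in> A e} = {e \<in> E. x \<in> A e} \<inter> S"
      "{e \<in> E - S. x \<in> A e} = {e \<in> E. x \<in> A e} - S" using E by auto
    ultimately show ?thesis using fin by (simp add: X_def imbalance_def)
  qed
  then have bnd: "\<bar>X x\<bar> \<le> d" if "x \<in> space M" for x using pat that by simp
  have X: "integrable M X"
    unfolding X_def using int E by (intro Bochner_Integration.integrable_diff Bochner_Integration.integrable_sum) auto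
  have "expectation X = (\<Sum>e\<in>S. prob (A e)) - (\<Sum>e\<in>E - S. prob (A e))"
    unfolding X_def using int E(2) A(1)
    by (subst Bochner_Integration.integral_diff)
      (auto simp: Bochner_Integration.integral_sum subset_iff intro!: Bochner_Integration.integrable_sum arg_cong2[where f = "(-)"] sum.cong)
  also have "\<dots> = a * p\<^sub>1 - b * p\<^sub>2"
  proof -
    have "(\<Sum>e\<in>S. prob (A e)) = (\<Sum>e\<in>S. p\<^sub>1)" "(\<Sum>e\<in>E - S. prob (A e)) = (\<Sum>e\<in>E - S. p\<^sub>2)"
      by (rule sum.cong[OF refl]; use A(2) E(2) in auto)+
    then show ?thesis by (simp add: a_def b_def)
  qed
  finally have "\<bar>a * p\<^sub>1 - b * p\<^sub>2\<bar> \<le> d"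
    using integral_le_const[OF X, of d] integral_ge_const[OF X, of "- d"] bnd
    by (force simp: abs_le_iff minus_le_iff intro: AE_I2)
  moreover have "E \<inter> S = S" using E by auto
  then have "\<bar>a - b\<bar> \<le> d" using bal by (simp add: imbalance_def a_def b_def)
  moreover have card: "real (card E) = a + b"
    using E fin by (simp add: a_def b_def card_Diff_subset card_mono of_nat_diff)
  moreover have "\<bar>(a - b) * (p\<^sub>1 + p\<^sub>2)\<bar> \<le> d * 2"
    unfolding abs_mult using calculation(2) p by (intro mult_mono) auto
  moreover have "card E * (p\<^sub>1 - p\<^sub>2) = 2 * (a * p\<^sub>1 - b * p\<^sub>2) - (a - b) * (p\<^sub>1 + p\<^sub>2)"
    unfolding card by (simp add: algebra_simps)
  moreover have "\<bar>2 * x - y\<bar> \<le> 4 * d" if "\<bar>x\<bar> \<le> d" "\<bar>y\<bar> \<le> d * 2" for x y :: real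
    using that by linarith
  ultimately have "\<bar>card E * (p\<^sub>1 - p\<^sub>2)\<bar> \<le> 4 * d" by metis
  then show ?thesis by (simp add: abs_mult)
qed

section \<open>Types and automorphisms\<close>

abbreviation map_pars :: "('a \<Rightarrow> 'b) \<Rightarrow> ('r, 'a) fm \<Rightarrow> ('r, 'b) fm" where
  "map_pars \<equiv> map_fm (\<lambda>R. R)"

definition y_subst :: "'a list \<Rightarrow> nat \<Rightarrow> 'a option" where
  "y_subst as v = (if 1 \<le> v \<and> v \<le> length as then Some (as ! (v - 1)) else None)"

lemma inst_y_eq: "inst_y \<phi> as = inst (y_subst as) \<phi>"
  by (simp add: inst_y_def y_subst_def[abs_def])

lemma map_trm_inst_y_subst:
  assumes "t \<in> Var ` {0..length as}"
  shows "map_trm g (inst_trm (y_subst as) t) = inst_trm (y_subst (map g as)) t"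
  using assms by (auto simp: y_subst_def)

text \<open>The formula \<phi> has no parameters of its own, so renaming parameters affects only the
  substituted tuple.\<close>

lemma map_pars_inst_y:
  assumes "bool_comb_x L n \<phi>" "length as = n"
  shows "map_pars g (inst_y \<phi> as) = inst_y \<phi> (map g as)"
  using assms
proof induction
  case (1 R ts)
  then show ?case
    by (auto simp: inst_y_eq intro!: map_trm_inst_y_subst)
next
  case (2 s t)
  then show ?case
    by (auto simp: inst_y_eq map_trm_inst_y_subst)
qed (auto simp: inst_y_eq)

lemma inst_y_in_formulas_x:
  assumes "bool_comb_x L n \<phi>" "length as = n" "set as \<subseteq> univ M"
  shows "inst_y \<phi> as \<in> formulas_x L M"
proof -
  have trm: "set_trm (inst_trm (y_subst as) t) \<subseteq> univ M"
    "inst_trm (y_subst as) t = Var v \<Longrightarrow> v = 0" if "t \<in> Var ` {0..n}" for t v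
    using that assms(2,3) by (auto simp: y_subst_def split: if_splits)
  show ?thesis using assms(1)
  proof induction
    case (1 R ts)
    then have ts: "t \<in> Var ` {0..n}" if "t \<in> set ts" for t using that by auto
    have "free_vars (inst_y (Rel R ts) as) \<subseteq> {0}"
    proof
      fix v assume "v \<in> free_vars (inst_y (Rel R ts) as)"
      then obtain t where "t \<in> set ts" "inst_trm (y_subst as) t = Var v"
        by (auto simp: inst_y_eq image_iff eq_commute)
      then show "v \<in> {0}" using trm(2)[OF ts] by simp
    qed
    moreover have "pars (inst_y (Rel R ts) as) \<subseteq> univ M"
      using trm(1)[OF ts] by (auto simp: inst_y_eq)
    ultimately show ?case using 1(1,2) by (simp add: formulas_x_def inst_y_eq)
  next
    case (2 s t)
    then have "s \<in> Var ` {0..n}" "t \<in> Var ` {0..n}" by auto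
    from trm[OF this(1)] trm[OF this(2)] show ?case
      by (auto simp: inst_y_eq formulas_x_def eq_commute)
  qed (auto simp: inst_y_eq formulas_x_def)
qed

section \<open>Complete types and the connectives\<close>

lemma types_x_Neg:
  assumes "p \<in> types_x L M" "\<phi> \<in> formulas_x L M"
  shows "Neg \<phi> \<in> p \<longleftrightarrow> \<phi> \<notin> p"
proof -
  have "\<not> {\<phi>, Neg \<phi>} \<subseteq> p"
    using assms(1) unfolding types_x_def
    by (smt (verit) finite.intros insertCI mem_Collect_eq sat.simps(3))
  then show ?thesis using assms by (auto simp: types_x_def)
qed

text \<open>A failure of the equivalence would put one of three unsatisfiable finite sets inside the
  finitely satisfiable \<open>p\<close>.\<close>

lemma types_x_Conj:
  assumes p: "p \<in> types_x L M" and \<phi>: "\<phi> \<in> formulas_x L M" and \<psi>: "\<psi> \<in> formulas_x L M"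
  shows "Conj \<phi> \<psi> \<in> p \<longleftrightarrow> \<phi> \<in> p \<and> \<psi> \<in> p"
proof -
  have C: "Conj \<phi> \<psi> \<in> formulas_x L M" using \<phi> \<psi> by (auto simp: formulas_x_def)
  have fin: "\<exists>a \<in> univ M. \<forall>\<theta> \<in> F. sat M (\<lambda>_. a) \<theta>" if "finite F" "F \<subseteq> p" for F
    using p that by (auto simp: types_x_def)
  have "\<not> {Neg \<phi>, Conj \<phi> \<psi>} \<subseteq> p" "\<not> {Neg \<psi>, Conj \<phi> \<psi>} \<subseteq> p" "\<not> {Neg (Conj \<phi> \<psi>), \<phi>, \<psi>} \<subseteq> p"
    using fin[of "{Neg \<phi>, Conj \<phi> \<psi>}"] fin[of "{Neg \<psi>, Conj \<phi> \<psi>}"] fin[of "{Neg (Conj \<phi> \<psi>), \<phi>, \<psi>}"]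
    by auto
  then show ?thesis
    using types_x_Neg[OF p \<phi>] types_x_Neg[OF p \<psi>] types_x_Neg[OF p C] by auto
qed

text \<open>The parameters are abstract vertices rather than elements of \<open>M\<close>, so that
  these formulas can be counted before any map from \<open>V\<close> to \<open>M\<close> is
  chosen.\<close>

definition atoms_x :: "'r language \<Rightarrow> 'v set \<Rightarrow> ('r, 'v) fm set" where
  "atoms_x L V =
     {Rel R ts | R ts. R \<in> symbols L \<and> length ts = arity L R \<and>
        set ts \<subseteq> insert (Var 0) (Par ` V) \<and> Var 0 \<in> set ts} \<union>
     {Eq s t | s t. {s, t} \<subseteq> insert (Var 0) (Par ` V) \<and> Var 0 \<in> {s, t}}"

text \<open>One of the \<open>k + 1\<close> argument places is taken by \<open>x\<close>, and each
  of the other \<open>k\<close> has \<open>card V + 1\<close> choices. This yields the exponent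
  \<open>k\<close>, which the number of hyperedges exceeds by \<alpha>.\<close>

lemma card_atoms_x:
  fixes L :: "'r language" and V :: "'v set"
  assumes L: "finite (symbols L)" "\<forall>R\<in>symbols L. arity L R = k + 1" and k: "k \<ge> 1" and V: "finite V"
  shows "finite (atoms_x L V)"
    and "card (atoms_x L V) \<le> (card (symbols L) * (k + 1) + 2) * (card V + 1) ^ k"
proof -
  define A where "A = insert (Var 0) (Par ` V)"
  have A: "finite A" "card A = card V + 1"
  proof -
    have "card (Par ` V) = card V" by (rule card_image) (auto simp: inj_on_def)
    then show "card A = card V + 1" using V by (simp add: A_def card_insert_if image_iff)
  qed (simp add: A_def V)
  define W where "W = {us. set us \<subseteq> A \<and> length us = k}"
  have W: "finite W" "card W = (card V + 1) ^ k"
    unfolding W_def using A finite_lists_length_eq card_lists_length_eq by metis+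
  \<comment> \<open>The triple records the symbol, the place of one occurrence of \<open>x\<close>
    and the remaining arguments. As \<open>x\<close> may occur again among these, the coding is not
    injective, but an upper bound only needs it to be onto.\<close>
  define B :: "('r, 'v) fm set" where "B = (\<lambda>(R, i, us). Rel R (take i us @ Var 0 # drop i us)) ` (symbols L \<times> {..k} \<times> W)"
  define C :: "('r, 'v) fm set" where "C = Eq (Var 0) ` A \<union> (\<lambda>t. Eq t (Var 0)) ` A"
  have "atoms_x L V \<subseteq> B \<union> C"
  proof
    fix \<psi> assume "\<psi> \<in> atoms_x L V"
    then consider R ts where "\<psi> = Rel R ts" "R \<in> symbols L" "length ts = k + 1" "set ts \<subseteq> A" "Var 0 \<in> set ts"
      | "\<psi> \<in> C"
      using L by (auto simp: atoms_x_def A_def C_def)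
    then show "\<psi> \<in> B \<union> C"
    proof cases
      case 1
      from 1(5) obtain us vs where ts: "ts = us @ Var 0 # vs" by (auto dest: split_list)
      then have "\<psi> = (\<lambda>(R, i, us). Rel R (take i us @ Var 0 # drop i us)) (R, length us, us @ vs)"
        using 1 by simp
      moreover have "(R, length us, us @ vs) \<in> symbols L \<times> {..k} \<times> W"
        using 1 ts by (auto simp: W_def)
      ultimately show ?thesis unfolding B_def by blast
    qed auto
  qed
  moreover have "finite B" "finite C" using A W L by (auto simp: B_def C_def)
  moreover have "card B \<le> card (symbols L) * (k + 1) * (card V + 1) ^ k"
  proof -
    have "card B \<le> card (symbols L \<times> {..k} \<times> W)"
      unfolding B_def by (rule card_image_le) (use L W in auto)
    then show ?thesis by (simp only: card_cartesian_product card_atMost W(2) Suc_eq_plus1 mult.assoc)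
  qed
  moreover have "card C \<le> 2 * (card V + 1) ^ k"
  proof -
    have "card C \<le> card A + card A"
      unfolding C_def using card_Un_le card_image_le[OF A(1)] by (meson add_mono le_trans)
    also have "\<dots> \<le> 2 * (card V + 1) ^ k"
      using A k self_le_power[of "card V + 1" k] by simp
    finally show ?thesis .
  qed
  ultimately have sub: "atoms_x L V \<subseteq> B \<union> C" and fin: "finite (B \<union> C)"
    and "card B + card C \<le> (card (symbols L) * (k + 1) + 2) * (card V + 1) ^ k"
    by (auto simp only: add_mult_distrib finite_Un intro: add_mono)
  then show "card (atoms_x L V) \<le> (card (symbols L) * (k + 1) + 2) * (card V + 1) ^ k"
    using card_mono[OF fin sub] card_Un_le[of B C] by linarith
  show "finite (atoms_x L V)" using sub fin by (rule finite_subset)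
qed

text \<open>It is essential that \<open>\<Phi>\<close> depends neither on the type nor on the map \<open>h\<close> to \<open>M\<close>.\<close>

lemma bool_comb_determined_by_atoms:
  fixes M :: "('a, 'r) struct" and \<phi> :: "('r, 'a) fm"
  assumes "bool_comb_x L n \<phi>"
  obtains \<Phi> :: "('r, 'v) fm set \<Rightarrow> 'v list \<Rightarrow> bool" where
    "\<And>p V h vs. p \<in> types_x L M \<Longrightarrow> h ` V \<subseteq> univ M \<Longrightarrow> length vs = n \<Longrightarrow> set vs \<subseteq> V \<Longrightarrow>
       inst_y \<phi> (map h vs) \<in> p \<longleftrightarrow> \<Phi> {\<psi> \<in> atoms_x L V. map_pars h \<psi> \<in> p} vs"
proof -
  let ?P = "\<lambda>\<phi> (\<Phi> :: ('r, 'v) fm set \<Rightarrow> 'v list \<Rightarrow> bool). \<forall>p V h vs. p \<in> types_x L M \<longrightarrow>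
      h ` V \<subseteq> univ M \<longrightarrow> length vs = n \<longrightarrow> set vs \<subseteq> V \<longrightarrow>
      (inst_y \<phi> (map h vs) \<in> p \<longleftrightarrow> \<Phi> {\<psi> \<in> atoms_x L V. map_pars h \<psi> \<in> p} vs)"
  \<comment> \<open>This only changes the type of parameters: the terms of \<phi> are variables, so
    \<open>undefined\<close> never appears. Then \<open>tr vs\<close> substitutes the vertices
    \<open>vs\<close> for the variables \<open>y\<close>.\<close>
  define strip where "strip = map_trm (\<lambda>_ :: 'a. undefined :: 'v)"
  define tr where "tr vs t = inst_trm (y_subst vs) (strip t)" for vs :: "'v list" and t :: "'a trm"
  have tr: "map_trm h (tr vs t) = inst_trm (y_subst (map h vs)) t"
    "tr vs t \<in> insert (Var 0) (Par ` set vs)" "tr vs (Var 0) = Var 0"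
    if "length vs = n" "t \<in> Var ` {0..n}" for h :: "'v \<Rightarrow> 'a" and vs and t :: "'a trm"
    using that by (auto simp: tr_def strip_def y_subst_def)
  have "\<exists>\<Phi>. ?P \<phi> \<Phi>" using assms
  proof induction
    case (1 R ts)
    show ?case
    proof (intro exI allI impI)
      fix p and V :: "'v set" and h :: "'v \<Rightarrow> 'a" and vs
      assume vs: "length vs = n" "set vs \<subseteq> V"
      have ts: "t \<in> Var ` {0..n}" if "t \<in> set ts" for t using that 1 by auto
      have "tr vs (Var 0) \<in> tr vs ` set ts" using 1(4) by (rule imageI)
      then have "Var 0 \<in> set (map (tr vs) ts)" using tr(3)[OF vs(1), of "Var 0"] by simp
      moreover have "set (map (tr vs) ts) \<subseteq> insert (Var 0) (Par ` V)"
        using tr(2)[OF vs(1) ts] vs(2) by auto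
      ultimately have "Rel R (map (tr vs) ts) \<in> atoms_x L V"
        unfolding atoms_x_def using 1(1,2) by simp
      moreover have "map_pars h (Rel R (map (tr vs) ts)) = inst_y (Rel R ts) (map h vs)"
        using tr(1)[OF vs(1) ts] by (simp add: inst_y_eq)
      ultimately show "inst_y (Rel R ts) (map h vs) \<in> p \<longleftrightarrow>
          (\<lambda>X vs. Rel R (map (tr vs) ts) \<in> X) {\<psi> \<in> atoms_x L V. map_pars h \<psi> \<in> p} vs"
        by simp
    qed
  next
    case (2 s t)
    show ?case
    proof (intro exI allI impI)
      fix p and V :: "'v set" and h :: "'v \<Rightarrow> 'a" and vs
      assume vs: "length vs = n" "set vs \<subseteq> V"
      have st: "s \<in> Var ` {0..n}" "t \<in> Var ` {0..n}" using 2 by auto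
      have in_V: "tr vs s \<in> insert (Var 0) (Par ` V)" "tr vs t \<in> insert (Var 0) (Par ` V)"
        using tr(2)[OF vs(1) st(1)] tr(2)[OF vs(1) st(2)] vs(2) by auto
      have tr0: "tr vs s = Var 0 \<or> tr vs t = Var 0"
        using 2(2) tr(3)[OF vs(1), of "Var 0"] by auto
      have "(Eq (tr vs s) (tr vs t) :: ('r, 'v) fm) \<in> atoms_x L V"
        unfolding atoms_x_def using in_V tr0 by auto
      moreover have "map_pars h (Eq (tr vs s) (tr vs t) :: ('r, 'v) fm) = inst_y (Eq s t) (map h vs)"
        using tr(1)[OF vs(1) st(1)] tr(1)[OF vs(1) st(2)] by (simp add: inst_y_eq)
      ultimately show "inst_y (Eq s t) (map h vs) \<in> p \<longleftrightarrow>
          (\<lambda>X vs. Eq (tr vs s) (tr vs t) \<in> X) {\<psi> \<in> atoms_x L V. map_pars h \<psi> \<in> p} vs"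
        by simp
    qed
  next
    case (3 \<phi>)
    from 3(2) obtain \<Phi> where \<Phi>: "?P \<phi> \<Phi>" by (elim exE)
    have "?P (Neg \<phi>) (\<lambda>X vs. \<not> \<Phi> X vs)"
    proof (intro allI impI)
      fix p and V :: "'v set" and h :: "'v \<Rightarrow> 'a" and vs
      assume *: "p \<in> types_x L M" "h ` V \<subseteq> univ M" "length vs = n" "set vs \<subseteq> V"
      have "inst_y \<phi> (map h vs) \<in> formulas_x L M"
        by (rule inst_y_in_formulas_x[OF 3(1)]) (use * in auto)
      with * \<Phi> show "inst_y (Neg \<phi>) (map h vs) \<in> p \<longleftrightarrow>
          \<not> \<Phi> {\<psi> \<in> atoms_x L V. map_pars h \<psi> \<in> p} vs"
        by (simp add: inst_y_eq types_x_Neg)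
    qed
    then show ?case by (rule exI[of _ "\<lambda>X vs. \<not> \<Phi> X vs"])
  next
    case (4 \<phi> \<phi>')
    from 4(3,4) obtain \<Phi> \<Phi>' where \<Phi>: "?P \<phi> \<Phi>" "?P \<phi>' \<Phi>'" by (elim exE)
    have "?P (Conj \<phi> \<phi>') (\<lambda>X vs. \<Phi> X vs \<and> \<Phi>' X vs)"
    proof (intro allI impI)
      fix p and V :: "'v set" and h :: "'v \<Rightarrow> 'a" and vs
      assume *: "p \<in> types_x L M" "h ` V \<subseteq> univ M" "length vs = n" "set vs \<subseteq> V"
      have "inst_y \<phi> (map h vs) \<in> formulas_x L M" "inst_y \<phi>' (map h vs) \<in> formulas_x L M"
        by (rule inst_y_in_formulas_x[OF 4(1)] inst_y_in_formulas_x[OF 4(2)]; use * in auto)+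
      with * \<Phi> show "inst_y (Conj \<phi> \<phi>') (map h vs) \<in> p \<longleftrightarrow>
          \<Phi> {\<psi> \<in> atoms_x L V. map_pars h \<psi> \<in> p} vs \<and> \<Phi>' {\<psi> \<in> atoms_x L V. map_pars h \<psi> \<in> p} vs"
        by (simp add: inst_y_eq types_x_Conj)
    qed
    then show ?case by (rule exI[of _ "\<lambda>X vs. \<Phi> X vs \<and> \<Phi>' X vs"])
  qed
  then obtain \<Phi> where "?P \<phi> \<Phi>" by (elim exE)
  then show thesis by (intro that[of \<Phi>]) simp
qed

section \<open>Automorphisms acting on formulas and types\<close>

lemma Aut_D:
  assumes "g \<in> Aut L M"
  shows "bij_betw g (univ M) (univ M)"
    and "\<And>R xs. R \<in> symbols L \<Longrightarrow> xs \<in> lists (univ M) \<Longrightarrow> map g xs \<in> interp M R \<longleftrightarrow> xs \<in> interp M R"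
  using assms by (auto simp: Aut_def is_iso_def is_embedding_def bij_betw_def)

text \<open>Members of \<open>Aut\<close> are unconstrained outside \<open>univ M\<close>, so the
  inverse is taken relative to \<open>univ M\<close>.\<close>

lemma inv_into_Aut:
  assumes "g \<in> Aut L M"
  shows "inv_into (univ M) g \<in> Aut L M"
proof -
  let ?g' = "inv_into (univ M) g"
  note g = Aut_D[OF assms]
  have g': "bij_betw ?g' (univ M) (univ M)" using g(1) by (rule bij_betw_inv_into)
  have "map ?g' xs \<in> interp M R \<longleftrightarrow> xs \<in> interp M R" if R: "R \<in> symbols L" and xs: "xs \<in> lists (univ M)" for R xs
  proof -
    have "map ?g' xs \<in> lists (univ M)" using xs bij_betwE[OF g'] by auto
    moreover have "map g (map ?g' xs) = xs"
      using xs by (auto simp: bij_betw_inv_into_right[OF g(1)] intro!: map_idI)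
    ultimately show ?thesis using g(2)[OF R, of "map ?g' xs"] by simp
  qed
  then show ?thesis using g' by (auto simp: Aut_def is_iso_def is_embedding_def bij_betw_def)
qed

text \<open>Types contain all first-order formulas, so quantifiers must be treated too: as
  \<open>g\<close> is onto, a witness may be sought in the form \<open>g a\<close>.\<close>

lemma sat_map_pars:
  assumes g: "g \<in> Aut L M"
  shows "wf_fm L \<phi> \<Longrightarrow> pars \<phi> \<subseteq> univ M \<Longrightarrow> range e \<subseteq> univ M \<Longrightarrow>
    sat M (g \<circ> e) (map_pars g \<phi>) \<longleftrightarrow> sat M e \<phi>"
proof (induction \<phi> arbitrary: e)
  case (Rel R ts)
  have ev: "eval_trm (g \<circ> e) (map_trm g t) = g (eval_trm e t)" for t by (cases t) auto
  have "eval_trm e t \<in> univ M" if "t \<in> set ts" for t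
    using Rel(2,3) that by (cases t) force+
  then have "map (eval_trm e) ts \<in> lists (univ M)" by auto
  moreover have "map (eval_trm (g \<circ> e)) (map (map_trm g) ts) = map g (map (eval_trm e) ts)"
    by (simp add: ev)
  moreover have "R \<in> symbols L" using Rel(1) by simp
  ultimately show ?case using Aut_D(2)[OF g] by (metis fm.map(1) sat.simps(1))
next
  case (Eq s t)
  have ev: "eval_trm (g \<circ> e) (map_trm g t) = g (eval_trm e t)" for t by (cases t) auto
  have "eval_trm e s \<in> univ M" "eval_trm e t \<in> univ M"
    using Eq by (cases s; cases t; auto)+
  then show ?case using Aut_D(1)[OF g] by (auto simp: ev[unfolded comp_def] bij_betw_def inj_on_eq_iff)
next
  case (Ex v \<phi>)
  have upd: "(g \<circ> e)(v := g a) = g \<circ> e(v := a)" for a by auto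
  have IH: "sat M (g \<circ> e(v := a)) (map_pars g \<phi>) \<longleftrightarrow> sat M (e(v := a)) \<phi>" if "a \<in> univ M" for a
    by (rule Ex.IH) (use Ex.prems that in auto)
  have "sat M (g \<circ> e) (map_pars g (Ex v \<phi>)) \<longleftrightarrow>
      (\<exists>b\<in>g ` univ M. sat M ((g \<circ> e)(v := b)) (map_pars g \<phi>))"
    using Aut_D(1)[OF g] by (simp only: fm.map sat.simps bij_betw_def)
  also have "\<dots> \<longleftrightarrow> (\<exists>a\<in>univ M. sat M (e(v := a)) \<phi>)"
  proof -
    have "sat M ((g \<circ> e)(v := g a)) (map_pars g \<phi>) \<longleftrightarrow> sat M (e(v := a)) \<phi>" if "a \<in> univ M" for a
      unfolding upd by (rule IH[OF that])
    then show ?thesis by blast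
  qed
  finally show ?case by (simp only: sat.simps)
qed auto

lemma map_pars_formulas_x:
  assumes "g \<in> Aut L M" "\<phi> \<in> formulas_x L M"
  shows "map_pars g \<phi> \<in> formulas_x L M"
proof -
  have "wf_fm L (map_pars g \<phi>) \<longleftrightarrow> wf_fm L \<phi>" by (induction \<phi>) auto
  moreover have Var: "Var v = map_trm g t \<longleftrightarrow> t = Var v" for v t by (cases t) auto
  have "free_vars (map_pars g \<phi>) = free_vars \<phi>"
    by (induction \<phi>) (auto simp: image_iff Var)
  moreover have "pars (map_pars g \<phi>) \<subseteq> univ M"
    using assms Aut_D(1)[OF assms(1)] by (auto simp: fm.set_map formulas_x_def bij_betw_def)
  ultimately show ?thesis using assms(2) by (auto simp: formulas_x_def)
qed

lemma map_pars_inv_into: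
  assumes g: "g \<in> Aut L M" and \<phi>: "\<phi> \<in> formulas_x L M"
  shows "map_pars g (map_pars (inv_into (univ M) g) \<phi>) = \<phi>"
    and "map_pars (inv_into (univ M) g) (map_pars g \<phi>) = \<phi>"
proof -
  have bij: "bij_betw g (univ M) (univ M)" using Aut_D(1)[OF g] .
  have pars: "pars \<phi> \<subseteq> univ M" using \<phi> by (simp add: formulas_x_def)
  have "map_pars g (map_pars (inv_into (univ M) g) \<phi>) = map_fm id id \<phi>"
    unfolding fm.map_comp
    by (rule fm.map_cong0) (use pars bij in \<open>auto simp: bij_betw_inv_into_right\<close>)
  then show "map_pars g (map_pars (inv_into (univ M) g) \<phi>) = \<phi>" by (simp add: fm.map_id)
  have "map_pars (inv_into (univ M) g) (map_pars g \<phi>) = map_fm id id \<phi>"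
    unfolding fm.map_comp
    by (rule fm.map_cong0) (use pars bij in \<open>auto simp: bij_betw_inv_into_left\<close>)
  then show "map_pars (inv_into (univ M) g) (map_pars g \<phi>) = \<phi>" by (simp add: fm.map_id)
qed

text \<open>Finite satisfiability is preserved because \<open>g\<close> moves a realisation to a
  realisation; completeness is obtained by pulling a formula back along the inverse of
  \<open>g\<close>.\<close>

lemma act_type_types_x:
  assumes g: "g \<in> Aut L M" and p: "p \<in> types_x L M"
  shows "act_type g p \<in> types_x L M"
proof -
  have p_fm: "p \<subseteq> formulas_x L M" using p by (simp add: types_x_def)
  have "\<exists>a\<in>univ M. \<forall>\<phi>\<in>F. sat M (\<lambda>_. a) \<phi>" if "finite F" "F \<subseteq> act_type g p" for F
  proof -
    have "\<exists>F'\<subseteq>p. finite F' \<and> F = map_pars g ` F'"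
      using that unfolding act_type_def by (rule finite_subset_image)
    then obtain F' where F': "F' \<subseteq> p" "finite F'" "F = map_pars g ` F'" by blast
    then obtain a where a: "a \<in> univ M" "\<And>\<phi>. \<phi> \<in> F' \<Longrightarrow> sat M (\<lambda>_. a) \<phi>"
      using p by (auto simp: types_x_def)
    have "sat M (g \<circ> (\<lambda>_. a)) (map_pars g \<phi>)" if "\<phi> \<in> F'" for \<phi>
      using that a F' p_fm by (subst sat_map_pars[OF g]) (auto simp: formulas_x_def)
    then show ?thesis using a(1) F'(3) bij_betwE[OF Aut_D(1)[OF g]]
      by (auto simp: comp_def)
  qed
  moreover have "\<phi> \<in> act_type g p \<or> Neg \<phi> \<in> act_type g p" if \<phi>: "\<phi> \<in> formulas_x L M" for \<phi>
  proof -
    let ?\<psi> = "map_pars (inv_into (univ M) g) \<phi>"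
    have "?\<psi> \<in> p \<or> Neg ?\<psi> \<in> p"
      using map_pars_formulas_x[OF inv_into_Aut[OF g] \<phi>] p by (auto simp: types_x_def)
    moreover have "map_pars g ?\<psi> = \<phi>" using map_pars_inv_into[OF g \<phi>] by simp
    moreover from this have "map_pars g (Neg ?\<psi>) = Neg \<phi>" by simp
    ultimately show ?thesis unfolding act_type_def by (metis imageI)
  qed
  moreover have "act_type g p \<subseteq> formulas_x L M"
    using p_fm map_pars_formulas_x[OF g] by (auto simp: act_type_def)
  ultimately show ?thesis by (auto simp: types_x_def)
qed

text \<open>This turns invariance of the measure into an equality between the measures of a formula
  and of its translate.\<close>

lemma act_type_types_containing:
  assumes g: "g \<in> Aut L M" and \<phi>: "\<phi> \<in> formulas_x L M"
  shows "act_type g ` types_containing L M \<phi> = types_containing L M (map_pars g \<phi>)"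
proof
  show "act_type g ` types_containing L M \<phi> \<subseteq> types_containing L M (map_pars g \<phi>)"
    using act_type_types_x[OF g] by (auto simp: types_containing_def act_type_def)
next
  show "types_containing L M (map_pars g \<phi>) \<subseteq> act_type g ` types_containing L M \<phi>"
  proof
    fix q assume "q \<in> types_containing L M (map_pars g \<phi>)"
    then have q: "q \<in> types_x L M" "map_pars g \<phi> \<in> q" by (auto simp: types_containing_def)
    let ?p = "act_type (inv_into (univ M) g) q"
    have "map_pars (inv_into (univ M) g) (map_pars g \<phi>) \<in> ?p"
      using q(2) unfolding act_type_def by (rule imageI)
    then have "?p \<in> types_containing L M \<phi>"
      using act_type_types_x[OF inv_into_Aut[OF g] q(1)] map_pars_inv_into(2)[OF g \<phi>]
      by (simp add: types_containing_def)
    moreover have "q \<subseteq> formulas_x L M" using q by (simp add: types_x_def)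
    then have "act_type g ?p = q"
      using map_pars_inv_into(1)[OF g] by (force simp: act_type_def image_image)
    ultimately show "q \<in> act_type g ` types_containing L M \<phi>" by (metis imageI)
  qed
qed

section \<open>Measures of formulas and homogeneity\<close>

lemma types_containing_measurable:
  assumes "keisler_measure L M \<mu>" "\<phi> \<in> formulas_x L M"
  shows "types_containing L M \<phi> \<in> sets \<mu>"
  using assms topology_generated_by_Basis[of "types_containing L M \<phi>" "types_containing L M ` formulas_x L M"]
  by (auto simp: keisler_measure_def regular_borel_measure_def stone_topology_def intro!: sigma_sets.Basic)

lemma space_keisler_measure:
  assumes "keisler_measure L M \<mu>"
  shows "space \<mu> \<subseteq> types_x L M"
  using assms by (auto simp: keisler_measure_def regular_borel_measure_def stone_topology_def types_containing_def)

text \<open>The map from \<open>a i\<close> to \<open>b i\<close> is an isomorphism of finite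
  substructures. Homogeneity extends it to an automorphism, which carries the first set of types
  onto the second.\<close>

lemma emeasure_eq_if_same_structure:
  fixes a b :: "nat \<Rightarrow> 'a"
  assumes M: "homogeneous L M" and \<mu>: "keisler_measure L M \<mu>" "invariant_measure L M \<mu>"
    and a: "inj_on a ({1..r})" "a ` {1..r} \<subseteq> univ M"
    and b: "inj_on b ({1..r})" "b ` {1..r} \<subseteq> univ M"
    and same: "\<And>R ys. R \<in> symbols L \<Longrightarrow> ys \<in> lists ({1..r}) \<Longrightarrow> map a ys \<in> interp M R \<longleftrightarrow> map b ys \<in> interp M R"
    and \<phi>: "bool_comb_x L (r) \<phi>"
  shows "emeasure \<mu> (types_containing L M (inst_y \<phi> (map a [1..<Suc r]))) =
         emeasure \<mu> (types_containing L M (inst_y \<phi> (map b [1..<Suc r])))"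
proof -
  define xs where "xs = [1..<Suc r]"
  have set_xs: "set xs = {1..r}" by (auto simp: xs_def)
  have length_xs: "length xs = r" by (simp add: xs_def)
  note a = a[folded set_xs] and b = b[folded set_xs] and same = same[folded set_xs]
    and \<phi> = \<phi>[folded length_xs]
  define f where "f = b \<circ> inv_into (set xs) a"
  have fa: "f (a i) = b i" if "i \<in> set xs" for i using that a by (simp add: f_def)
  have "is_iso L f (substructure M (a ` set xs)) (substructure M (b ` set xs))"
  proof -
    have "f ` a ` set xs = b ` set xs" using fa by force
    moreover have "inj_on f (a ` set xs)" using fa a b by (auto simp: inj_on_def)
    moreover have "zs \<in> interp M R \<longleftrightarrow> map f zs \<in> interp M R"
      if R: "R \<in> symbols L" and zs: "zs \<in> lists (a ` set xs)" for R zs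
    proof -
      obtain ys where ys: "ys \<in> lists (set xs)" "zs = map a ys" using zs by (auto simp: lists_image)
      then have "map f zs = map b ys" using fa by auto
      then show ?thesis using same[OF R ys(1)] ys(2) by metis
    qed
    moreover have "map f zs \<in> lists (b ` set xs)" if "zs \<in> lists (a ` set xs)" for zs
      using that fa by fastforce
    ultimately show ?thesis
      by (simp add: is_iso_def is_embedding_def substructure_def del: in_lists_conv_set set_map)
  qed
  then obtain g where g: "g \<in> Aut L M" "\<And>x. x \<in> a ` set xs \<Longrightarrow> g x = f x"
    using M a b unfolding homogeneous_def by (metis finite_imageI finite_set)
  have ab: "map g (map a xs) = map b xs" using g fa by auto
  have in_fm: "inst_y \<phi> (map a xs) \<in> formulas_x L M"
    by (rule inst_y_in_formulas_x[OF \<phi>]) (use a in auto)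
  have "emeasure \<mu> (act_type g ` types_containing L M (inst_y \<phi> (map a xs))) =
      emeasure \<mu> (types_containing L M (inst_y \<phi> (map a xs)))"
    using \<mu>(2) g(1) types_containing_measurable[OF \<mu>(1) in_fm] by (simp add: invariant_measure_def)
  moreover have "map_pars g (inst_y \<phi> (map a xs)) = inst_y \<phi> (map b xs)"
    unfolding ab[symmetric] by (rule map_pars_inst_y[OF \<phi>]) simp
  ultimately show ?thesis
    unfolding xs_def[symmetric] using act_type_types_containing[OF g(1) in_fm] by simp
qed

section \<open>Gluing structures along a hypergraph\<close>

text \<open>The structure induced on a tuple, transported to the domain that
  \<open>members_on\<close> requires.\<close>

definition pullback :: "('a, 'r) struct \<Rightarrow> (nat \<Rightarrow> 'a) \<Rightarrow> nat \<Rightarrow> (nat, 'r) struct" where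
  "pullback M a r = \<lparr>univ = {1..r}, interp = (\<lambda>R. {ys \<in> lists {1..r}. map a ys \<in> interp M R})\<rparr>"

lemma pullback_in_Age:
  assumes "is_structure L M" "inj_on a {1..r}" "a ` {1..r} \<subseteq> univ M"
  shows "pullback M a r \<in> members_on (Age L M) r"
proof -
  have "is_structure L (pullback M a r)"
    using assms(1) by (force simp: is_structure_def pullback_def distinct_map)
  moreover have "is_embedding L a (pullback M a r) M"
    using assms(2,3) by (simp add: is_embedding_def pullback_def)
  ultimately show ?thesis by (auto simp: members_on_def Age_def pullback_def)
qed

text \<open>Here \<open>\<beta> e\<close> enumerates the hyperedge \<open>e\<close> and
  \<open>H e\<close> is the structure to be copied onto it. No other tuples are added.\<close>

definition glue :: "nat set \<Rightarrow> nat set set \<Rightarrow> (nat set \<Rightarrow> nat \<Rightarrow> nat) \<Rightarrow> (nat set \<Rightarrow> (nat, 'r) struct) \<Rightarrow> (nat, 'r) struct" where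
  "glue V E \<beta> H = \<lparr>univ = V, interp = (\<lambda>R. \<Union>e\<in>E. map (\<beta> e) ` interp (H e) R)\<rparr>"

locale gluing =
  fixes L :: "'r language" and k r :: nat and V :: "nat set" and E :: "nat set set"
    and \<beta> :: "nat set \<Rightarrow> nat \<Rightarrow> nat" and H :: "nat set \<Rightarrow> (nat, 'r) struct"
  assumes arity: "\<And>R. R \<in> symbols L \<Longrightarrow> arity L R > k"
    and edge: "\<And>e. e \<in> E \<Longrightarrow> e \<subseteq> V"
    and overlap: "\<And>e e'. e \<in> E \<Longrightarrow> e' \<in> E \<Longrightarrow> e \<noteq> e' \<Longrightarrow> card (e \<inter> e') \<le> k"
    and \<beta>: "\<And>e. e \<in> E \<Longrightarrow> bij_betw (\<beta> e) {1..r} e"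
    and H: "\<And>e. e \<in> E \<Longrightarrow> is_structure L (H e)" "\<And>e. e \<in> E \<Longrightarrow> univ (H e) = {1..r}"
begin

abbreviation "G\<^sub>0 \<equiv> glue V E \<beta> H"

lemma univ_glue [simp]: "univ G\<^sub>0 = V"
  by (simp add: glue_def)

lemma H_tuple:
  assumes "e \<in> E" "R \<in> symbols L" "ys \<in> interp (H e) R"
  shows "set ys \<subseteq> {1..r}" "length ys = arity L R" "distinct ys"
  using assms H by (auto simp: is_structure_def)

lemma is_structure_glue: "is_structure L G\<^sub>0"
  unfolding is_structure_def
proof (intro ballI subsetI)
  fix R zs assume R: "R \<in> symbols L" and "zs \<in> interp G\<^sub>0 R"
  then obtain e ys where e: "e \<in> E" "ys \<in> interp (H e) R" "zs = map (\<beta> e) ys"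
    by (auto simp: glue_def)
  note ys = H_tuple[OF e(1) R e(2)]
  have "inj_on (\<beta> e) (set ys)" "\<beta> e ` set ys \<subseteq> e"
    using \<beta>[OF e(1)] ys(1) by (auto simp: bij_betw_def intro: inj_on_subset)
  then show "zs \<in> {xs. set xs \<subseteq> univ G\<^sub>0 \<and> length xs = arity L R \<and> distinct xs}"
    using ys e(3) edge[OF e(1)] by (auto simp: glue_def distinct_map)
qed

text \<open>No tuple of a relation lies in two hyperedges, since these meet in at most \<open>k\<close> vertices.\<close>

lemma interp_glue:
  assumes e: "e \<in> E" and R: "R \<in> symbols L" and ys: "ys \<in> lists {1..r}"
  shows "map (\<beta> e) ys \<in> interp G\<^sub>0 R \<longleftrightarrow> ys \<in> interp (H e) R"
proof
  assume "map (\<beta> e) ys \<in> interp G\<^sub>0 R"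
  then obtain e' zs where e': "e' \<in> E" "zs \<in> interp (H e') R" "map (\<beta> e) ys = map (\<beta> e') zs"
    by (auto simp: glue_def)
  note zs = H_tuple[OF e'(1) R e'(2)]
  have inj: "inj_on (\<beta> e') (set zs)"
    using \<beta>[OF e'(1)] zs(1) by (auto simp: bij_betw_def intro: inj_on_subset)
  have "e = e'"
  proof (rule ccontr)
    assume "e \<noteq> e'"
    \<comment> \<open>The entries of the common tuple lie in both hyperedges, and they are pairwise
      distinct, so there are more than \<open>k\<close> of them.\<close>
    have "\<beta> e' ` set zs \<subseteq> e'" using \<beta>[OF e'(1)] zs(1) by (auto simp: bij_betw_def)
    moreover have "\<beta> e ` set ys \<subseteq> e" using \<beta>[OF e] ys by (auto simp: bij_betw_def)
    moreover have "\<beta> e ` set ys = \<beta> e' ` set zs" using e'(3) by (metis set_map)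
    moreover have "finite (e \<inter> e')" using \<beta>[OF e] by (metis bij_betw_finite finite_Int finite_atLeastAtMost)
    ultimately have "card (\<beta> e' ` set zs) \<le> card (e \<inter> e')" by (intro card_mono) auto
    moreover have "card (\<beta> e' ` set zs) = arity L R"
      using card_image[OF inj] zs by (simp add: distinct_card)
    ultimately show False using overlap[OF e e'(1) \<open>e \<noteq> e'\<close>] arity[OF R] by simp
  qed
  moreover have "ys = zs"
  proof (rule map_inj_on)
    show "map (\<beta> e') ys = map (\<beta> e') zs" using e'(3) \<open>e = e'\<close> by simp
    show "inj_on (\<beta> e') (set ys \<union> set zs)"
      by (rule inj_on_subset[of _ "{1..r}"]) (use \<beta>[OF e'(1)] ys zs(1) in \<open>auto simp: bij_betw_def\<close>)
  qed
  ultimately show "ys \<in> interp (H e) R" using e' by simp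
qed (use e in \<open>auto simp: glue_def\<close>)

lemma isomorphic_edge:
  assumes e: "e \<in> E"
  shows "isomorphic L (substructure G\<^sub>0 e) (H e)"
proof -
  define f where "f = inv_into {1..r} (\<beta> e)"
  have f: "bij_betw f e {1..r}" unfolding f_def using \<beta>[OF e] by (rule bij_betw_inv_into)
  have "zs \<in> interp G\<^sub>0 R \<longleftrightarrow> map f zs \<in> interp (H e) R" if R: "R \<in> symbols L" and zs: "zs \<in> lists e" for R zs
  proof -
    have "map f zs \<in> lists {1..r}" using zs bij_betwE[OF f] by auto
    moreover have "\<beta> e (f z) = z" if "z \<in> set zs" for z
      unfolding f_def using that zs by (intro bij_betw_inv_into_right[OF \<beta>[OF e]]) auto
    then have "map (\<beta> e) (map f zs) = zs" by (simp add: map_idI)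
    ultimately show ?thesis using interp_glue[OF e R, of "map f zs"] by simp
  qed
  then have "is_iso L f (substructure G\<^sub>0 e) (H e)"
    using f H(2)[OF e] by (auto simp: is_iso_def is_embedding_def substructure_def bij_betw_def)
  then show ?thesis by (auto simp: isomorphic_def)
qed

end

section \<open>Exchangeability\<close>

text \<open>The order of choices is decisive: the hypergraph, the enumerations of its hyperedges and
  the family \<open>\<F>\<close> come first, then \<open>S\<close>, and only then the map to
  \<open>M\<close>, which depends on \<open>S\<close>.\<close>

lemma emeasure_eq_of_overlap_closed:
  fixes L :: "'r language" and M :: "('a, 'r) struct" and a b :: "nat \<Rightarrow> 'a"
  assumes k: "k \<ge> 1" and L: "finite (symbols L)" "\<forall>R \<in> symbols L. arity L R = k + 1"
    and M: "is_structure L M" "homogeneous L M" and oc: "overlap_closed L k (Age L M)"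
    and \<mu>: "keisler_measure L M \<mu>" "invariant_measure L M \<mu>"
    and r: "r > k"
    and a: "inj_on a {1..r}" "a ` {1..r} \<subseteq> univ M"
    and b: "inj_on b {1..r}" "b ` {1..r} \<subseteq> univ M"
    and \<phi>: "bool_comb_x L r \<phi>"
  shows "emeasure \<mu> (types_containing L M (inst_y \<phi> (map a [1..<Suc r]))) =
         emeasure \<mu> (types_containing L M (inst_y \<phi> (map b [1..<Suc r])))"
proof (rule ccontr)
  interpret prob_space \<mu> using \<mu>(1) by (simp add: keisler_measure_def)
  let ?ids = "[1..<Suc r]"
  have ids: "set ?ids = {1..r}" "length ?ids = r" by auto
  define P where "P c = prob (types_containing L M (inst_y \<phi> (map c ?ids)))" for c
  assume "emeasure \<mu> (types_containing L M (inst_y \<phi> (map a ?ids))) \<noteq>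
          emeasure \<mu> (types_containing L M (inst_y \<phi> (map b ?ids)))"
  then have "P a \<noteq> P b" by (simp add: P_def emeasure_eq_measure)
  \<comment> \<open>Any divisor above the constant 4 of \<open>prob_difference_le_imbalance\<close>
    gives the final contradiction.\<close>
  define \<epsilon> where "\<epsilon> = \<bar>P a - P b\<bar> / 5"
  have \<epsilon>: "\<epsilon> > 0" using \<open>P a \<noteq> P b\<close> by (simp add: \<epsilon>_def)
  note oc_r = mp[OF spec[OF conjunct2[OF oc[unfolded overlap_closed_def]], of r] r]
  from oc_r obtain c \<alpha> :: real where c: "c > 0" "\<alpha> > 0" and oc': "\<forall>N. \<exists>n \<ge> N. \<exists>V E.
        uniform_hypergraph r V E \<and> card V = n \<and>
        real (card E) \<ge> c * real n powr (real k + \<alpha>) \<and>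
        (\<forall>e \<in> E. \<forall>e' \<in> E. e \<noteq> e' \<longrightarrow> card (e \<inter> e') \<le> k) \<and>
        (\<forall>H1 \<in> members_on (Age L M) r. \<forall>H2 \<in> members_on (Age L M) r. \<forall>G0 :: (nat, 'r) struct.
           is_structure L G0 \<and> univ G0 = V \<and>
           (\<forall>e \<in> E. isomorphic L (substructure G0 e) H1 \<or> isomorphic L (substructure G0 e) H2) \<longrightarrow>
           (\<exists>G \<in> Age L M. card (univ G) = n \<and>
              (\<exists>f. is_hom L f G0 G \<and> inj_on f (univ G0) \<and>
                   (\<forall>e \<in> E. is_embedding L f (substructure G0 e) G))))"
    by (elim exE conjE) (rule that)
  define d where "d = card (symbols L) * (k + 1) + 2"
  have "\<epsilon>\<^sup>2 / 2 > 0" using \<epsilon> by simp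
  from eventually_few_patterns[OF c this, of k d] obtain N where N: "N \<ge> 1"
    "\<And>n m. n \<ge> N \<Longrightarrow> m \<ge> c * real n powr (real k + \<alpha>) \<Longrightarrow>
        2 * (2 ^ (d * (n + 1) ^ k) + 1) < exp (\<epsilon>\<^sup>2 / 2 * m)" by blast
  from oc' obtain n V E where n: "n \<ge> N" and hyp: "uniform_hypergraph r V E" "card V = n"
    and many: "real (card E) \<ge> c * real n powr (real k + \<alpha>)"
    and overlap: "\<forall>e \<in> E. \<forall>e' \<in> E. e \<noteq> e' \<longrightarrow> card (e \<inter> e') \<le> k"
    and embed: "\<forall>H1 \<in> members_on (Age L M) r. \<forall>H2 \<in> members_on (Age L M) r. \<forall>G0 :: (nat, 'r) struct.
           is_structure L G0 \<and> univ G0 = V \<and>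
           (\<forall>e \<in> E. isomorphic L (substructure G0 e) H1 \<or> isomorphic L (substructure G0 e) H2) \<longrightarrow>
           (\<exists>G \<in> Age L M. card (univ G) = n \<and>
              (\<exists>f. is_hom L f G0 G \<and> inj_on f (univ G0) \<and>
                   (\<forall>e \<in> E. is_embedding L f (substructure G0 e) G)))"
    by (elim allE[of _ N] exE conjE) (rule that)
  have V: "finite V" and edge: "\<And>e. e \<in> E \<Longrightarrow> e \<subseteq> V \<and> card e = r"
    using hyp(1) by (auto simp: uniform_hypergraph_def)
  have E: "finite E" using V edge by (meson PowI finite_Pow_iff finite_subset subsetI)
  \<comment> \<open>Since \<open>N \<ge> 1\<close>, the lower bound on the number of hyperedges is
    positive; the last inequality of the proof needs this to be strict.\<close>
  have m: "card E > 0"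
  proof -
    have "0 < c * real n powr (real k + \<alpha>)" using c n N(1) by simp
    then show ?thesis using many by linarith
  qed
  have "\<exists>\<beta>. bij_betw \<beta> {1..r} e" if "e \<in> E" for e
    using edge[OF that] V ex_bij_betw_nat_finite_1[of e] finite_subset by metis
  then obtain \<beta> where \<beta>: "\<And>e. e \<in> E \<Longrightarrow> bij_betw (\<beta> e) {1..r} e" by metis
  obtain \<Phi> :: "('r, nat) fm set \<Rightarrow> nat list \<Rightarrow> bool" where \<Phi>:
    "\<And>p V h vs. p \<in> types_x L M \<Longrightarrow> h ` V \<subseteq> univ M \<Longrightarrow> length vs = r \<Longrightarrow> set vs \<subseteq> V \<Longrightarrow>
       inst_y \<phi> (map h vs) \<in> p \<longleftrightarrow> \<Phi> {\<psi> \<in> atoms_x L V. map_pars h \<psi> \<in> p} vs"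
    using bool_comb_determined_by_atoms[OF \<phi>] by blast
  \<comment> \<open>These are the hyperedges on which a type satisfies \<phi> if \<open>X\<close> is
    the set of atomic formulas over \<open>V\<close> whose images it contains. Adding
    \<open>E\<close> to the family below makes \<open>S\<close> contain about half of all
    hyperedges.\<close>
  define pattern where "pattern X = {e \<in> E. \<Phi> X (map (\<beta> e) ?ids)}" for X
  define \<F> where "\<F> = insert E (pattern ` Pow (atoms_x L V))"
  have atoms: "finite (atoms_x L V)" "card (atoms_x L V) \<le> d * (n + 1) ^ k"
    using card_atoms_x[OF L k V] hyp(2) by (auto simp: d_def)
  have \<F>: "finite \<F>" "\<F> \<subseteq> Pow E" using atoms(1) by (auto simp: \<F>_def pattern_def)
  have "card \<F> \<le> Suc (card (pattern ` Pow (atoms_x L V)))"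
    unfolding \<F>_def using atoms(1) by (simp add: card_insert_if)
  also have "\<dots> \<le> Suc (card (Pow (atoms_x L V)))"
    using card_image_le[of "Pow (atoms_x L V)" pattern] atoms(1) by simp
  also have "\<dots> \<le> 2 ^ (d * (n + 1) ^ k) + 1"
    using atoms by (simp add: card_Pow)
  finally have "card \<F> \<le> 2 ^ (d * (n + 1) ^ k) + 1" .
  then have "real (card \<F>) \<le> real (2 ^ (d * (n + 1) ^ k) + 1)"
    by (rule of_nat_mono)
  then have "real (card \<F>) \<le> 2 ^ (d * (n + 1) ^ k) + 1"
    by (simp only: of_nat_add of_nat_power of_nat_numeral of_nat_1)
  then have "2 * real (card \<F>) < exp (\<epsilon>\<^sup>2 / 2 * card E)"
    by (intro le_less_trans[OF mult_left_mono N(2)[OF n many]]) simp_all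
  then obtain S where S: "S \<subseteq> E" "\<And>T. T \<in> \<F> \<Longrightarrow> \<bar>imbalance S T\<bar> \<le> \<epsilon> * card E"
    using exists_balanced_subset[OF E \<F> \<epsilon>] by blast
  define ab where "ab e = (if e \<in> S then a else b)" for e
  define H where "H e = pullback M (ab e) r" for e
  have H: "H e \<in> members_on (Age L M) r" for e
    unfolding H_def ab_def using pullback_in_Age[OF M(1)] a b by auto
  interpret gluing L k r V E \<beta> H
  proof
    show "is_structure L (H e)" "univ (H e) = {1..r}" for e
      using H[of e] by (auto simp: members_on_def Age_def)
    show "card (e \<inter> e') \<le> k" if "e \<in> E" "e' \<in> E" "e \<noteq> e'" for e e'
      using overlap that by simp
    show "arity L R > k" if "R \<in> symbols L" for R using L(2) that by simp
  qed (simp_all only: edge \<beta>)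
  have "\<exists>G \<in> Age L M. card (univ G) = n \<and> (\<exists>f. is_hom L f G\<^sub>0 G \<and> inj_on f (univ G\<^sub>0) \<and>
      (\<forall>e \<in> E. is_embedding L f (substructure G\<^sub>0 e) G))"
  proof (rule embed[THEN bspec, THEN bspec, THEN spec, THEN mp])
    show "pullback M a r \<in> members_on (Age L M) r" "pullback M b r \<in> members_on (Age L M) r"
      using pullback_in_Age[OF M(1)] a b by auto
    have "\<forall>e\<in>E. isomorphic L (substructure G\<^sub>0 e) (pullback M a r) \<or>
                isomorphic L (substructure G\<^sub>0 e) (pullback M b r)"
    proof
      fix e assume "e \<in> E"
      from isomorphic_edge[OF this]
      show "isomorphic L (substructure G\<^sub>0 e) (pullback M a r) \<or>
            isomorphic L (substructure G\<^sub>0 e) (pullback M b r)"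
        by (cases "e \<in> S") (simp_all add: H_def ab_def)
    qed
    then show "is_structure L G\<^sub>0 \<and> univ G\<^sub>0 = V \<and>
        (\<forall>e\<in>E. isomorphic L (substructure G\<^sub>0 e) (pullback M a r) \<or>
                isomorphic L (substructure G\<^sub>0 e) (pullback M b r))"
      using is_structure_glue by simp
  qed
  then obtain G f where G: "G \<in> Age L M" and f: "is_hom L f G\<^sub>0 G" "inj_on f (univ G\<^sub>0)"
    "\<forall>e\<in>E. is_embedding L f (substructure G\<^sub>0 e) G"
    by (elim bexE exE conjE) (rule that)
  from G obtain g where g: "is_embedding L g G M" by (auto simp: Age_def)
  \<comment> \<open>As \<open>f\<close> is only a homomorphism on the whole of
    \<open>G\<^sub>0\<close>, relations are reflected by \<open>h\<close> only inside hyperedges.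
    This suffices, because each \<open>A e\<close> concerns a single hyperedge.\<close>
  define h where "h = g \<circ> f"
  have fV: "f ` V \<subseteq> univ G" using f(1) by (simp add: is_hom_def)
  have h: "h ` V \<subseteq> univ M" "inj_on h V"
    using fV f(2) g inj_on_subset[OF _ fV, of g]
    by (auto simp: h_def is_embedding_def intro!: comp_inj_on)
  define A where "A e = types_containing L M (inst_y \<phi> (map (h \<circ> \<beta> e) ?ids))" for e
  have h\<beta>: "inj_on (h \<circ> \<beta> e) {1..r}" "(h \<circ> \<beta> e) ` {1..r} \<subseteq> univ M" if e: "e \<in> E" for e
  proof -
    have \<beta>e: "inj_on (\<beta> e) {1..r}" "\<beta> e ` {1..r} = e" using \<beta>[OF e] by (simp_all only: bij_betw_def)
    have "inj_on h e" using h(2) edge[OF e] inj_on_subset by blast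
    then show "inj_on (h \<circ> \<beta> e) {1..r}" using \<beta>e by (intro comp_inj_on) (simp_all only:)
    show "(h \<circ> \<beta> e) ` {1..r} \<subseteq> univ M"
      unfolding image_comp[symmetric] \<beta>e(2) using h(1) edge[OF e] by blast
  qed
  have same: "map (h \<circ> \<beta> e) ys \<in> interp M R \<longleftrightarrow> map (ab e) ys \<in> interp M R"
    if e: "e \<in> E" and R: "R \<in> symbols L" and ys: "ys \<in> lists {1..r}" for e R ys
  proof -
    have \<beta>e: "map (\<beta> e) ys \<in> lists e" using ys bij_betwE[OF \<beta>[OF e]] by auto
    moreover have "f x \<in> univ G" if "x \<in> e" for x using that edge[OF e] fV by blast
    then have "map f (map (\<beta> e) ys) \<in> lists (univ G)" using \<beta>e by auto
    ultimately have "map g (map f (map (\<beta> e) ys)) \<in> interp M R \<longleftrightarrow> map (\<beta> e) ys \<in> interp G\<^sub>0 R"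
      using g bspec[OF f(3) e] R by (simp add: is_embedding_def substructure_def del: map_map in_lists_conv_set)
    also have "\<dots> \<longleftrightarrow> ys \<in> interp (H e) R" by (rule interp_glue[OF e R ys])
    finally show ?thesis using ys by (simp add: H_def pullback_def h_def comp_assoc)
  qed
  have "card E * \<bar>P a - P b\<bar> \<le> 4 * (\<epsilon> * card E)"
  proof (rule prob_difference_le_imbalance[OF E S(1), of A])
    fix e assume e: "e \<in> E"
    have ab: "inj_on (ab e) {1..r}" "ab e ` {1..r} \<subseteq> univ M" using a b by (auto simp: ab_def)
    show "A e \<in> events"
      unfolding A_def using h\<beta>(2)[OF e] \<phi>
      by (intro types_containing_measurable[OF \<mu>(1)] inst_y_in_formulas_x[OF \<phi>]) auto
    have "emeasure \<mu> (A e) = emeasure \<mu> (types_containing L M (inst_y \<phi> (map (ab e) ?ids)))"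
      unfolding A_def
      by (rule emeasure_eq_if_same_structure[OF M(2) \<mu>])
        (use h\<beta>[OF e] ab same[OF e] \<phi> in simp_all)
    then show "prob (A e) = (if e \<in> S then P a else P b)"
      by (simp add: P_def ab_def measure_def)
  next
    fix p assume "p \<in> space \<mu>"
    then have p: "p \<in> types_x L M" using space_keisler_measure[OF \<mu>(1)] by auto
    have "p \<in> A e \<longleftrightarrow> \<Phi> {\<psi> \<in> atoms_x L V. map_pars h \<psi> \<in> p} (map (\<beta> e) ?ids)" if e: "e \<in> E" for e
    proof -
      have "set (map (\<beta> e) ?ids) \<subseteq> V" unfolding set_map ids using bij_betwE[OF \<beta>[OF e]] edge[OF e] by auto
      from \<Phi>[OF p h(1) _ this] show ?thesis using p
        by (simp add: A_def types_containing_def del: upt_Suc)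
    qed
    \<comment> \<open>Although \<open>h\<close> depends on \<open>S\<close>, the resulting set
      belongs to the family that was fixed before \<open>S\<close>.\<close>
    then have "{e \<in> E. p \<in> A e} = pattern {\<psi> \<in> atoms_x L V. map_pars h \<psi> \<in> p}"
      by (auto simp: pattern_def)
    then have "{e \<in> E. p \<in> A e} \<in> \<F>" by (auto simp: \<F>_def)
    then show "\<bar>imbalance S {e \<in> E. p \<in> A e}\<bar> \<le> \<epsilon> * card E" by (rule S(2))
  next
    show "\<bar>imbalance S E\<bar> \<le> \<epsilon> * card E" by (rule S(2)) (simp add: \<F>_def)
  qed (auto simp: P_def)
  then have "5 * (\<epsilon> * card E) \<le> 4 * (\<epsilon> * card E)" by (simp add: \<epsilon>_def)
  moreover have "\<epsilon> * card E > 0" using \<epsilon> m by simp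
  ultimately show False by linarith
qed

theorem theorem4p31:
  fixes k :: nat and L :: "'r language" and M :: "('a, 'r) struct"
    and \<mu> :: "('r, 'a) fm set measure"
  assumes "k \<ge> 1"
    and "finite (symbols L)"
    and "\<forall>R \<in> symbols L. arity L R = k + 1"
    and "is_structure L M"
    and "countable (univ M)"
    and "homogeneous L M"
    and "transitive_on_tuples L k M"
    and "overlap_closed L k (Age L M)"
    and "keisler_measure L M \<mu>"
    and "invariant_measure L M \<mu>"
  shows "exchangeable L M \<mu>"
  unfolding exchangeable_def
proof (intro allI ballI impI)
  fix n and as bs :: "'a list" and \<phi> :: "('r, 'a) fm"
  assume as: "as \<in> distinct_tuples n (univ M)" and bs: "bs \<in> distinct_tuples n (univ M)"
    and \<phi>: "bool_comb_x L n \<phi>"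
  \<comment> \<open>The shift matches positions of a list, counted from 0, with the domain
    \<open>{1..n}\<close> used for the age.\<close>
  define nth1 where "nth1 cs i = cs ! (i - 1)" for cs :: "'a list" and i
  have nth1: "map (nth1 cs) [1..<Suc n] = cs" "inj_on (nth1 cs) {1..n}" "nth1 cs ` {1..n} \<subseteq> univ M"
    if "cs \<in> distinct_tuples n (univ M)" for cs
  proof -
    have cs: "length cs = n" "distinct cs" "set cs \<subseteq> univ M" using that by (auto simp: distinct_tuples_def)
    show eq: "map (nth1 cs) [1..<Suc n] = cs" by (rule nth_equalityI) (use cs in \<open>auto simp: nth1_def simp del: upt_Suc\<close>)
    have set: "set [1..<Suc n] = {1..n}" by auto
    show "inj_on (nth1 cs) {1..n}" "nth1 cs ` {1..n} \<subseteq> univ M"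
      using cs(2,3) distinct_map[of "nth1 cs" "[1..<Suc n]"] set_map[of "nth1 cs" "[1..<Suc n]"]
      unfolding eq set by auto
  qed
  have "emeasure \<mu> (types_containing L M (inst_y \<phi> (map (nth1 as) [1..<Suc n]))) =
        emeasure \<mu> (types_containing L M (inst_y \<phi> (map (nth1 bs) [1..<Suc n])))"
  proof (cases "n > k")
    case True
    then show ?thesis
      using emeasure_eq_of_overlap_closed[OF assms(1-4,6,8-10)] nth1[OF as] nth1[OF bs] \<phi> by blast
  next
    case False
    have set: "set [1..<Suc n] = {1..n}" by auto
    \<comment> \<open>A related tuple would have \<open>k + 1\<close> distinct entries, more than
      the \<open>n\<close> available indices.\<close>
    have no_rel: "map c ys \<notin> interp M R"
      if "R \<in> symbols L" "ys \<in> lists {1..n}" for c R ys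
    proof
      assume "map c ys \<in> interp M R"
      then have "length (map c ys) = arity L R" "distinct (map c ys)"
        using subsetD[OF bspec[OF assms(4)[unfolded is_structure_def] that(1)]] by blast+
      then have "length ys = k + 1" "distinct ys" using assms(3) that(1) by (simp_all add: distinct_map)
      then have "card (set ys) = k + 1" by (simp add: distinct_card)
      moreover have "card (set ys) \<le> card {1..n}" using that(2) by (intro card_mono) auto
      ultimately show False using False by simp
    qed
    show ?thesis
      by (rule emeasure_eq_if_same_structure[OF assms(6,9,10)])
        (use nth1(2,3)[OF as] nth1(2,3)[OF bs] no_rel \<phi> in simp_all)
  qed
  then show "emeasure \<mu> (types_containing L M (inst_y \<phi> as)) = emeasure \<mu> (types_containing L M (inst_y \<phi> bs))"
    unfolding nth1(1)[OF as] nth1(1)[OF bs] .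
qed

end
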